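(* Let $\nu$ be a Borel probability measure on $\mathbb{R}^d$ whose support lies in the interior of $[0,1]^d$, and assume that there are $a>0$ and $C\ge1$ with $\nu(Q)\le C2^{-ak}$ for all $Q\in\mathcal D_k$, $k\ge0$. Let $r>-\dim_\infty(\nu)$ and put $$\mathcal J_r(Q)=\sup_{Q'\subseteq Q,\ Q'\in\mathcal D}\nu(Q')\ell(Q')^r,\qquad \Theta_r(q)=\limsup_{k\to\infty}\frac1k\log\sum_{Q\in\mathcal D_k}\mathcal J_r(Q)^q,\quad q>0,$$ and $q_r=\inf\{q>0:\Theta_r(q)<0\}$. Then $q_r$ is the unique solution of $$\overline\beta(q_r)=rq_r.$$ In particular $q_0=1$, $q_r>1$ for $r<0$, $q_r<1$ for $r>0$, and $q_r\to1$ as $r\to0$.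
   Context: $\log$ is the logarithm to base 2. $\mathcal D_k$ is the partition of the root cube $[0,1]^d$ into $2^{dk}$ dyadic cubes of side length $2^{-k}$ (half-open cubes, with the outer boundary faces of $[0,1]^d$ assigned to the adjacent end cubes, so that the partitions are disjoint and nested, $\mathcal D_0=\{[0,1]^d\}$); $\mathcal D=\bigcup_{k\ge0}\mathcal D_k$, $\ell(Q)=2^{-k}$ for $Q\in\mathcal D_k$. Zero-mass cubes are omitted from mass sums. $\dim_\infty(\nu)=\liminf_{k\to\infty}\frac{-\log\max_{Q\in\mathcal D_k}\nu(Q)}{k}$, which is positive under the mass hypothesis. $\beta_k(q)=\frac1k\log\sum_{Q\in\mathcal D_k,\nu(Q)>0}\nu(Q)^q$ and $\overline\beta(q)=\limsup_k\beta_k(q)$ for $q>0$. "Unique solution" refers to $q\in(0,\infty)$. *)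

theory Defs
  imports "HOL-Probability.Probability"
begin

definition measure_support :: "'a::topological_space measure \<Rightarrow> 'a set" where
  "measure_support \<nu> = {x. \<forall>U. open U \<longrightarrow> x \<in> U \<longrightarrow> emeasure \<nu> U > 0}"

(* The half-open dyadic cube of side length 2^(-k) with corner m / 2^k. In each coordinate in
   which it is the last cube, it also contains its face on the boundary of the unit cube. *)
definition dyadic_cube :: "nat \<Rightarrow> ('n::finite \<Rightarrow> nat) \<Rightarrow> (real ^ 'n) set" where
  "dyadic_cube k m =
     {x. \<forall>i. real (m i) / 2 ^ k \<le> x $ i \<and>
            (x $ i < (real (m i) + 1) / 2 ^ k \<or> (m i + 1 = 2 ^ k \<and> x $ i = 1))}"

definition dyadic_cubes :: "nat \<Rightarrow> (real ^ 'n::finite) set set" where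
  "dyadic_cubes k = dyadic_cube k ` {m. \<forall>i. m i < 2 ^ k}"

definition all_dyadic_cubes :: "(real ^ 'n::finite) set set" where
  "all_dyadic_cubes = (\<Union>k. dyadic_cubes k)"

(* Cubes of different generations are different sets, so the generation of a dyadic cube is
   well defined; see side_length_dyadic_cubes below. *)
definition side_length :: "(real ^ 'n::finite) set \<Rightarrow> real" where
  "side_length Q = (1 / 2) ^ (THE k. Q \<in> dyadic_cubes k)"

lemma dyadic_cubes_level_unique:
  fixes Q :: "(real ^ 'n::finite) set"
  assumes "Q \<in> dyadic_cubes j" and "Q \<in> dyadic_cubes k"
  shows "j = k"
proof -
  have bounds: "(\<forall>x\<in>Q. \<forall>y\<in>Q. \<forall>i. x $ i - y $ i \<le> 1 / 2 ^ k) \<and>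
      (\<forall>e<1 / 2 ^ k. \<exists>x\<in>Q. \<exists>y\<in>Q. \<exists>i. e < x $ i - y $ i)"
    if Qk: "Q \<in> dyadic_cubes k" for k
  proof -
    from Qk obtain m where m: "Q = dyadic_cube k m"
      by (auto simp: dyadic_cubes_def)
    have upper: "x $ i - y $ i \<le> 1 / 2 ^ k" if "x \<in> Q" "y \<in> Q" for x y i
    proof -
      have "x $ i \<le> (real (m i) + 1) / 2 ^ k"
      proof (cases "x $ i < (real (m i) + 1) / 2 ^ k")
        case False
        then have *: "m i + 1 = 2 ^ k" "x $ i = 1"
          using that(1) by (auto simp: m dyadic_cube_def)
        have "real (m i) + 1 = 2 ^ k"
          using arg_cong[OF *(1), of real] by simp
        with *(2) show ?thesis by simp
      qed simp
      moreover have "real (m i) / 2 ^ k \<le> y $ i"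
        using that(2) by (auto simp: m dyadic_cube_def)
      ultimately show ?thesis by (simp add: add_divide_distrib)
    qed
    have lower: "\<exists>x\<in>Q. \<exists>y\<in>Q. \<exists>i. e < x $ i - y $ i" if "e < 1 / 2 ^ k" for e :: real
    proof -
      have "max e 0 < 1 / 2 ^ k" using that by simp
      then obtain t where t: "max e 0 < t" "t < 1 / 2 ^ k"
        using dense by blast
      define y :: "real ^ 'n" where "y = (\<chi> i. real (m i) / 2 ^ k)"
      define x :: "real ^ 'n" where "x = (\<chi> i. real (m i) / 2 ^ k + t)"
      have "x \<in> Q" "y \<in> Q"
        using t by (auto simp: m dyadic_cube_def x_def y_def add_divide_distrib)
      moreover have "e < x $ i - y $ i" for i
        using t by (simp add: x_def y_def)
      ultimately show ?thesis by blast
    qed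
    from upper lower show ?thesis by blast
  qed
  have le: "1 / 2 ^ j \<le> (1 / 2 ^ k :: real)"
    if "Q \<in> dyadic_cubes j" "Q \<in> dyadic_cubes k" for j k
    using bounds[OF that(1)] bounds[OF that(2)] by (meson leD leI)
  have "(1 / 2 ^ j :: real) = 1 / 2 ^ k"
    using le assms by (meson order_antisym)
  then show ?thesis by simp
qed

lemma side_length_dyadic_cubes:
  "Q \<in> dyadic_cubes k \<Longrightarrow> side_length Q = (1 / 2) ^ k"
  unfolding side_length_def
  by (metis (mono_tags, lifting) dyadic_cubes_level_unique the_equality)

definition dim_infty :: "(real ^ 'n::finite) measure \<Rightarrow> ereal" where
  "dim_infty \<nu> =
     liminf (\<lambda>k. ereal (- log 2 (Max (measure \<nu> ` dyadic_cubes k)) / real k))"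

definition beta :: "(real ^ 'n::finite) measure \<Rightarrow> nat \<Rightarrow> real \<Rightarrow> real" where
  "beta \<nu> k q =
     1 / real k * log 2 (\<Sum>Q\<in>{Q \<in> dyadic_cubes k. measure \<nu> Q > 0}. measure \<nu> Q powr q)"

definition beta_upper :: "(real ^ 'n::finite) measure \<Rightarrow> real \<Rightarrow> ereal" where
  "beta_upper \<nu> q = limsup (\<lambda>k. ereal (beta \<nu> k q))"

(* A real supremum: the set is bounded above when r > - dim_infty nu. *)
definition J :: "(real ^ 'n::finite) measure \<Rightarrow> real \<Rightarrow> (real ^ 'n) set \<Rightarrow> real" where
  "J \<nu> r Q =
     (SUP Q'\<in>{Q' \<in> all_dyadic_cubes. Q' \<subseteq> Q}. measure \<nu> Q' * side_length Q' powr r)"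

(* Cubes of mass zero contribute nothing, as 0 powr q = 0. *)
definition Theta :: "(real ^ 'n::finite) measure \<Rightarrow> real \<Rightarrow> real \<Rightarrow> ereal" where
  "Theta \<nu> r q =
     limsup (\<lambda>k. ereal (1 / real k * log 2 (\<Sum>Q\<in>dyadic_cubes k. J \<nu> r Q powr q)))"

definition crit_exponent :: "(real ^ 'n::finite) measure \<Rightarrow> real \<Rightarrow> real" where
  "crit_exponent \<nu> r = Inf {q. q > 0 \<and> Theta \<nu> r q < 0}"

end

theory Submission
  imports Defs
begin

text \<open>
  Write \<open>B\<close> for the upper exponent \<open>beta_upper \<nu>\<close> and let \<open>D\<close> be positive with \<open>- r < D < dim_infty \<nu>\<close>.
  By Hoelder's inequality \<open>B\<close> is convex, hence continuous, and since eventually no cube of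
  generation \<open>k\<close> has mass above \<open>2 powr (- D * k)\<close>, it satisfies \<open>B q \<le> B p - D * (q - p)\<close> for \<open>p \<le> q\<close>.
  With \<open>B 1 = 0\<close> this gives \<open>\<lambda>q. B q - r * q\<close> exactly one zero and locates it relative to \<open>1\<close>.
  The critical exponent is this zero because \<open>Theta \<nu> r q < 0\<close> iff \<open>B q < r * q\<close>: the cube itself
  bounds \<open>J\<close> from below, and conversely \<open>J \<nu> r Q powr q\<close> is at most the sum of the \<open>q\<close>-th
  powers over all subcubes of \<open>Q\<close>, so that \<open>B q < r * q\<close> bounds the sum over generation \<open>k\<close> by the
  tail of a convergent geometric series.
\<close>

section \<open>Geometry of dyadic cubes\<close>

abbreviation unit_cube :: "(real ^ 'n::finite) set" where
  "unit_cube \<equiv> {x. \<forall>i. 0 \<le> x $ i \<and> x $ i \<le> 1}"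

text \<open>Any point of a cube determines its index by taking floors. The cap at
  \<open>2 ^ k - 1\<close> handles the outer face \<open>x $ i = 1\<close>, where the floor is
  \<open>2 ^ k\<close> although the point belongs to the last cube. Disjointness within a generation
  follows.\<close>

lemma dyadic_cube_index:
  assumes "x \<in> dyadic_cube k m" "m i < 2 ^ k"
  shows "int (m i) = min \<lfloor>2 ^ k * x $ i\<rfloor> (2 ^ k - 1)"
proof -
  have lo: "real (m i) \<le> 2 ^ k * x $ i"
    using assms(1) by (auto simp: dyadic_cube_def divide_le_eq mult.commute)
  have m: "int (m i) \<le> 2 ^ k - 1"
    using assms(2) by (metis int_ops(1) of_nat_less_iff of_nat_numeral of_nat_power zle_diff1_eq)
  from assms(1) consider "x $ i < (real (m i) + 1) / 2 ^ k" | "m i + 1 = 2 ^ k" "x $ i = 1"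
    by (auto simp: dyadic_cube_def)
  then show ?thesis
  proof cases
    case 1
    then have "2 ^ k * x $ i < real (m i) + 1"
      by (simp add: less_divide_eq mult.commute)
    with lo have "\<lfloor>2 ^ k * x $ i\<rfloor> = int (m i)"
      by (intro floor_unique) auto
    with m show ?thesis by simp
  next
    case 2
    then have "int (m i) + 1 = 2 ^ k"
      by (metis of_nat_1 of_nat_add of_nat_numeral of_nat_power)
    moreover have "\<lfloor>2 ^ k * x $ i\<rfloor> = 2 ^ k"
      using 2 by (metis floor_numeral_power mult.right_neutral)
    ultimately show ?thesis by simp
  qed
qed

lemma dyadic_cubes_disjoint:
  assumes "Q \<in> dyadic_cubes k" "Q' \<in> dyadic_cubes k" "x \<in> Q" "x \<in> Q'"
  shows "Q = Q'"
proof -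
  obtain m m' where m: "Q = dyadic_cube k m" "\<forall>i. m i < 2 ^ k"
    and m': "Q' = dyadic_cube k m'" "\<forall>i. m' i < 2 ^ k"
    using assms(1,2) by (auto simp: dyadic_cubes_def)
  have "m = m'"
    using dyadic_cube_index[of x k m] dyadic_cube_index[of x k m'] m m' assms(3,4)
    by (intro ext) (metis of_nat_eq_iff)
  then show ?thesis using m m' by simp
qed

lemma Union_dyadic_cubes: "\<Union> (dyadic_cubes k) = (unit_cube :: (real ^ 'n::finite) set)"
proof (intro equalityI subsetI)
  fix x :: "real ^ 'n" assume "x \<in> \<Union> (dyadic_cubes k)"
  then obtain m where m: "x \<in> dyadic_cube k m" "\<forall>i. m i < 2 ^ k"
    by (auto simp: dyadic_cubes_def)
  have "0 \<le> x $ i \<and> x $ i \<le> 1" for i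
  proof -
    have "m i + 1 \<le> 2 ^ k" using m(2) by (simp add: Suc_le_eq)
    then have "real (m i + 1) \<le> real (2 ^ k)" by (rule of_nat_mono)
    then have *: "(real (m i) + 1) / 2 ^ k \<le> 1" by (simp add: divide_le_eq)
    have "0 \<le> real (m i) / 2 ^ k" by simp
    moreover have "real (m i) / 2 ^ k \<le> x $ i"
      and "x $ i < (real (m i) + 1) / 2 ^ k \<or> x $ i = 1"
      using m(1) by (auto simp: dyadic_cube_def)
    ultimately show ?thesis using * by linarith
  qed
  then show "x \<in> unit_cube" by simp
next
  fix x :: "real ^ 'n" assume x: "x \<in> unit_cube"
  \<comment> \<open>The only candidate index, by \<open>dyadic_cube_index\<close>: the floor,
    lowered by one exactly on the outer face.\<close>
  define m where "m i = nat (min \<lfloor>2 ^ k * x $ i\<rfloor> (2 ^ k - 1))" for i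
  have m: "int (m i) = min \<lfloor>2 ^ k * x $ i\<rfloor> (2 ^ k - 1)" for i
    using x by (simp add: m_def)
  have lt: "m i < 2 ^ k" for i
  proof -
    have "int (m i) < int (2 ^ k)" using m[of i] by simp
    then show ?thesis by (simp only: of_nat_less_iff)
  qed
  have "x \<in> dyadic_cube k m"
    unfolding dyadic_cube_def
  proof (intro CollectI allI conjI)
    fix i
    have xi: "0 \<le> x $ i" "x $ i \<le> 1" using x by auto
    have "real_of_int (int (m i)) \<le> 2 ^ k * x $ i"
      unfolding m by (rule order_trans[OF _ of_int_floor_le[of "2 ^ k * x $ i"]]) simp
    then show "real (m i) / 2 ^ k \<le> x $ i"
      by (simp add: divide_le_eq mult.commute)
    show "x $ i < (real (m i) + 1) / 2 ^ k \<or> m i + 1 = 2 ^ k \<and> x $ i = 1"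
    proof (cases "x $ i = 1")
      case True
      then have "2 ^ k * x $ i = of_int (2 ^ k)" by simp
      then have "\<lfloor>2 ^ k * x $ i\<rfloor> = 2 ^ k" by (metis floor_of_int)
      then have "int (m i + 1) = int (2 ^ k)" using m[of i] by simp
      then show ?thesis using True by (metis of_nat_eq_iff)
    next
      case False
      then have "2 ^ k * x $ i < of_int (2 ^ k)" using xi by simp
      then have "\<lfloor>2 ^ k * x $ i\<rfloor> < 2 ^ k" by (metis floor_less_iff)
      then have "int (m i) = \<lfloor>2 ^ k * x $ i\<rfloor>" using m[of i] by simp
      then have "2 ^ k * x $ i < real (m i) + 1"
        using real_of_int_floor_add_one_gt[of "2 ^ k * x $ i"]
        by (metis of_int_of_nat_eq)
      then show ?thesis by (simp add: less_divide_eq mult.commute)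
    qed
  qed
  then show "x \<in> \<Union> (dyadic_cubes k)"
    using lt by (auto simp: dyadic_cubes_def)
qed

text \<open>As a dependent product, the index set falls under \<open>finite_PiE\<close> and
  \<open>card_PiE\<close>.\<close>

lemma dyadic_indices_eq: "{m::'n::finite \<Rightarrow> nat. \<forall>i. m i < 2 ^ k} = (\<Pi>\<^sub>E i\<in>UNIV. {..<2 ^ k})"
  by auto

lemma finite_dyadic_cubes: "finite (dyadic_cubes k :: (real ^ 'n::finite) set set)"
  unfolding dyadic_cubes_def dyadic_indices_eq by (intro finite_imageI finite_PiE) auto

lemma card_dyadic_cubes_le: "card (dyadic_cubes k :: (real ^ 'n::finite) set set) \<le> 2 ^ (k * CARD('n))"
proof -
  have "card (dyadic_cubes k :: (real ^ 'n) set set) \<le> card {m::'n \<Rightarrow> nat. \<forall>i. m i < 2 ^ k}"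
    unfolding dyadic_cubes_def by (rule card_image_le) (simp only: dyadic_indices_eq finite_PiE finite finite_lessThan)
  also have "\<dots> = 2 ^ (k * CARD('n))"
    by (simp add: dyadic_indices_eq card_PiE power_mult)
  finally show ?thesis .
qed

lemma dyadic_cubes_nonempty: "dyadic_cubes k \<noteq> {}"
  by (auto simp: dyadic_cubes_def intro: exI[of _ "\<lambda>_. 0"])

lemma dyadic_cube_corner: "t \<ge> 0 \<Longrightarrow> t < 1 / 2 ^ k \<Longrightarrow> (\<chi> i. real (m i) / 2 ^ k + t) \<in> dyadic_cube k m"
  by (auto simp: dyadic_cube_def add_divide_distrib)

lemma dyadic_cubes_member_nonempty: "Q \<in> dyadic_cubes k \<Longrightarrow> Q \<noteq> {}"
  using dyadic_cube_corner[of 0 k] by (auto simp: dyadic_cubes_def)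

lemma dyadic_cubes_diff_le:
  assumes "Q \<in> dyadic_cubes k" "x \<in> Q" "y \<in> Q"
  shows "x $ i - y $ i \<le> 1 / 2 ^ k"
proof -
  obtain m where m: "Q = dyadic_cube k m"
    using assms by (auto simp: dyadic_cubes_def)
  have "x $ i \<le> (real (m i) + 1) / 2 ^ k"
  proof (cases "x $ i < (real (m i) + 1) / 2 ^ k")
    case False
    then have *: "m i + 1 = 2 ^ k" "x $ i = 1"
      using assms by (auto simp: m dyadic_cube_def)
    have "real (m i) + 1 = 2 ^ k"
      using arg_cong[OF *(1), of real] by simp
    with *(2) show ?thesis by simp
  qed simp
  moreover have "real (m i) / 2 ^ k \<le> y $ i"
    using assms by (auto simp: m dyadic_cube_def)
  ultimately show ?thesis by (simp add: add_divide_distrib)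
qed

text \<open>A cube of generation \<open>j\<close> has two points whose coordinates differ by almost
  \<open>1 / 2 ^ j\<close>. If \<open>j < k\<close>, this exceeds the spread
  \<open>1 / 2 ^ k\<close> allowed inside \<open>Q\<close>.\<close>

lemma dyadic_cubes_subset_level:
  fixes Q :: "(real ^ 'n::finite) set"
  assumes "Q' \<in> dyadic_cubes j" "Q \<in> dyadic_cubes k" "Q' \<subseteq> Q"
  shows "k \<le> j"
proof (rule ccontr)
  assume "\<not> k \<le> j"
  then have "(2::real) ^ j < 2 ^ k" by simp
  then have "1 / 2 ^ k < (1 / 2 ^ j :: real)" by (simp add: frac_less2)
  then obtain t where t: "1 / 2 ^ k < t" "t < (1 / 2 ^ j :: real)" using dense by blast
  have t0: "0 < t" using t(1) by (smt (verit) divide_pos_pos zero_less_power)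
  obtain m where m: "Q' = dyadic_cube j m"
    using assms by (auto simp: dyadic_cubes_def)
  have "(\<chi> i. real (m i) / 2 ^ j + t) \<in> Q" "(\<chi> i. real (m i) / 2 ^ j + 0) \<in> Q"
    using dyadic_cube_corner[of t j m] dyadic_cube_corner[of 0 j m] t t0 assms(3) m by auto
  from dyadic_cubes_diff_le[OF assms(2) this] show False using t by simp
qed

lemma borel_dyadic_cubes:
  assumes "Q \<in> dyadic_cubes k" shows "Q \<in> sets borel"
proof -
  obtain m where m: "Q = dyadic_cube k m" using assms by (auto simp: dyadic_cubes_def)
  have "{x::real^'a. real (m i) / 2 ^ k \<le> x $ i \<and>
            (x $ i < (real (m i) + 1) / 2 ^ k \<or> (m i + 1 = 2 ^ k \<and> x $ i = 1))} \<in> sets borel" for i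
    by measurable
  then have "(\<Inter>i. {x::real^'a. real (m i) / 2 ^ k \<le> x $ i \<and>
            (x $ i < (real (m i) + 1) / 2 ^ k \<or> (m i + 1 = 2 ^ k \<and> x $ i = 1))}) \<in> sets borel"
    by (intro sets.finite_INT) auto
  also have "(\<Inter>i. {x::real^'a. real (m i) / 2 ^ k \<le> x $ i \<and>
            (x $ i < (real (m i) + 1) / 2 ^ k \<or> (m i + 1 = 2 ^ k \<and> x $ i = 1))}) = Q"
    by (auto simp: m dyadic_cube_def)
  finally show ?thesis .
qed

text \<open>The complement of the support is the union of all open null sets. By the Lindelof
  property countably many of them suffice, so the union is null.\<close>

lemma null_Compl_measure_support:
  fixes \<nu> :: "'a::second_countable_topology measure"
  assumes "sets \<nu> = sets borel"
  shows "- measure_support \<nu> \<in> null_sets \<nu>"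
proof -
  define F where "F = {U. open U \<and> emeasure \<nu> U = 0}"
  obtain F' where F': "F' \<subseteq> F" "countable F'" "\<Union>F' = \<Union>F"
    using Lindelof[of F] by (auto simp: F_def)
  have "\<Union>F' \<in> null_sets \<nu>"
    using F' assms by (intro null_sets_UN'[of F' "\<lambda>x. x", simplified]) (auto simp: F_def null_sets_def)
  moreover have "\<Union>F = - measure_support \<nu>"
    by (auto simp: F_def measure_support_def)
  ultimately show ?thesis using F' by simp
qed

section \<open>Upper exponent of power sums\<close>

text \<open>Translates strict upper bounds on exponents into eventual bounds with a real margin, the
  only form in which limits superior are handled below.\<close>

lemma limsup_ereal_less_iff:
  "limsup (\<lambda>k. ereal (f k)) < ereal x \<longleftrightarrow> (\<exists>y<x. \<forall>\<^sub>F k in sequentially. f k \<le> y)"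
proof
  assume "limsup (\<lambda>k. ereal (f k)) < ereal x"
  then obtain y where y: "limsup (\<lambda>k. ereal (f k)) < ereal y" "y < x"
    using ereal_dense2 less_ereal.simps(1) by blast
  then have "\<forall>\<^sub>F k in sequentially. f k \<le> y"
    using Limsup_lessD[OF y(1)] by (auto elim: eventually_mono)
  with y show "\<exists>y<x. \<forall>\<^sub>F k in sequentially. f k \<le> y" by blast
next
  assume "\<exists>y<x. \<forall>\<^sub>F k in sequentially. f k \<le> y"
  then obtain y where "y < x" "\<forall>\<^sub>F k in sequentially. ereal (f k) \<le> ereal y" by auto
  then show "limsup (\<lambda>k. ereal (f k)) < ereal x"
    using Limsup_bounded[of "\<lambda>k. ereal (f k)" "ereal y" sequentially] le_less_trans by fastforce
qed

lemma weighted_geometric_le_arithmetic: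
  fixes x y t :: real
  assumes "x \<ge> 0" "y \<ge> 0" "0 < t" "t < 1"
  shows "x powr (1 - t) * y powr t \<le> (1 - t) * x + t * y"
proof (cases "x = 0 \<or> y = 0")
  case False
  then have pos: "x > 0" "y > 0" using assms by auto
  then show ?thesis using Youngs_inequality_0[of "1 - t" t x y] assms by simp
qed (use assms in auto)

text \<open>Hoelder's inequality with exponents \<open>1 / (1 - t)\<close> and \<open>1 / t\<close>:
  normalise both sums to 1 and apply the weighted inequality of geometric and arithmetic means to
  each term.\<close>

lemma sum_powr_log_convex:
  fixes f :: "'a \<Rightarrow> real"
  assumes "finite A" "\<And>x. x \<in> A \<Longrightarrow> f x \<ge> 0" "0 < t" "t < 1"
    and P: "(\<Sum>x\<in>A. f x powr p) > 0" and R: "(\<Sum>x\<in>A. f x powr q) > 0"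
  shows "(\<Sum>x\<in>A. f x powr ((1 - t) * p + t * q))
    \<le> (\<Sum>x\<in>A. f x powr p) powr (1 - t) * (\<Sum>x\<in>A. f x powr q) powr t"
proof -
  define P R where PR: "P = (\<Sum>x\<in>A. f x powr p)" "R = (\<Sum>x\<in>A. f x powr q)"
  have pos: "P > 0" "R > 0" using P R by (auto simp: PR)
  have "(\<Sum>x\<in>A. f x powr ((1 - t) * p + t * q)) =
        P powr (1 - t) * R powr t * (\<Sum>x\<in>A. (f x powr p / P) powr (1 - t) * (f x powr q / R) powr t)"
    unfolding sum_distrib_left
  proof (intro sum.cong refl)
    fix x assume "x \<in> A"
    show "f x powr ((1 - t) * p + t * q) =
        P powr (1 - t) * R powr t * ((f x powr p / P) powr (1 - t) * (f x powr q / R) powr t)"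
      using pos by (simp add: powr_divide powr_powr powr_add mult.commute)
  qed
  also have "\<dots> \<le> P powr (1 - t) * R powr t *
      (\<Sum>x\<in>A. (1 - t) * (f x powr p / P) + t * (f x powr q / R))"
    using pos assms by (intro mult_left_mono sum_mono weighted_geometric_le_arithmetic) auto
  also have "(\<Sum>x\<in>A. (1 - t) * (f x powr p / P) + t * (f x powr q / R)) = 1"
    using pos by (simp add: sum.distrib sum_distrib_left[symmetric] sum_divide_distrib[symmetric] PR)
  finally show ?thesis by (simp add: PR)
qed

text \<open>Removes the logarithm from a rate. Generation 0 is excluded because
  \<open>1 / real 0\<close> is 0, which is why later estimates are restricted to eventually positive
  \<open>k\<close>.\<close>

lemma log_2_rate_le_iff:
  assumes "k > 0" "s > 0"
  shows "1 / real k * log 2 s \<le> y \<longleftrightarrow> s \<le> 2 powr (y * real k)"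
  using assms by (simp add: log_le_iff divide_le_eq)

text \<open>Full mass on the closed unit cube makes the masses of the cubes of each generation sum
  to 1.\<close>

locale unit_cube_prob = prob_space \<nu> for \<nu> :: "(real ^ 'n::finite) measure" +
  assumes sets_borel: "sets \<nu> = sets borel"
    and prob_unit_cube: "measure \<nu> unit_cube = 1"
begin

text \<open>Cubes of mass zero are kept, since \<open>0 powr q = 0\<close>; \<open>beta_eq\<close>
  identifies this with the sum over cubes of positive mass.\<close>

definition power_sum :: "nat \<Rightarrow> real \<Rightarrow> real" where
  "power_sum k q = (\<Sum>Q\<in>dyadic_cubes k. measure \<nu> Q powr q)"

text \<open>A real-valued version, so that convexity and continuity can be stated. For
  \<open>q > 0\<close> no information is lost, by \<open>beta_upper_eq\<close>.\<close>

definition real_beta :: "real \<Rightarrow> real" where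
  "real_beta q = real_of_ereal (beta_upper \<nu> q)"

text \<open>The form in which the bound \<open>D < dim_infty \<nu>\<close> is used: a uniform
  exponential bound on all cubes of large generation.\<close>

definition decay_rate :: "real \<Rightarrow> bool" where
  "decay_rate D \<longleftrightarrow>
    (\<forall>\<^sub>F k in sequentially. \<forall>Q\<in>dyadic_cubes k. measure \<nu> Q \<le> 2 powr (- D * real k))"

lemma sum_measure_dyadic_cubes: "(\<Sum>Q\<in>dyadic_cubes k. measure \<nu> Q) = 1"
proof -
  have "measure \<nu> (\<Union>Q\<in>dyadic_cubes k. Q) = (\<Sum>Q\<in>dyadic_cubes k. measure \<nu> Q)"
    using borel_dyadic_cubes
    by (intro finite_measure_finite_Union)
       (auto simp: finite_dyadic_cubes sets_borel disjoint_family_on_def dest: dyadic_cubes_disjoint)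
  then show ?thesis by (simp add: Union_dyadic_cubes prob_unit_cube)
qed

lemma beta_eq: "beta \<nu> k q = 1 / real k * log 2 (power_sum k q)"
proof -
  have "(\<Sum>Q\<in>{Q \<in> dyadic_cubes k. measure \<nu> Q > 0}. measure \<nu> Q powr q) = power_sum k q"
    unfolding power_sum_def
    by (intro sum.mono_neutral_left)
       (auto simp: finite_dyadic_cubes not_less measure_le_0_iff)
  then show ?thesis by (simp add: beta_def)
qed

text \<open>Pigeonhole: mass 1 is spread over at most \<open>2 ^ (k * CARD('n))\<close> cubes. This
  keeps power sums and maximal masses positive, so that their logarithms are meaningful.\<close>

lemma ex_dyadic_cube_measure_ge:
  "\<exists>Q\<in>dyadic_cubes k. measure \<nu> Q \<ge> 1 / 2 ^ (k * CARD('n))"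
proof (rule ccontr)
  assume "\<not> ?thesis"
  then have "(\<Sum>Q\<in>dyadic_cubes k. measure \<nu> Q)
      < (\<Sum>Q\<in>(dyadic_cubes k :: (real^'n) set set). 1 / 2 ^ (k * CARD('n)))"
    by (intro sum_strict_mono) (auto simp: finite_dyadic_cubes dyadic_cubes_nonempty not_le)
  also have "\<dots> \<le> 1"
    using of_nat_mono[OF card_dyadic_cubes_le[where 'n='n, of k], where 'a=real]
    by (simp add: divide_le_eq)
  finally show False by (simp add: sum_measure_dyadic_cubes)
qed

lemma power_sum_ge:
  fixes q :: real
  assumes "q > 0" shows "2 powr (- (CARD('n) * q) * k) \<le> power_sum k q"
proof -
  obtain Q where Q: "Q \<in> dyadic_cubes k" "measure \<nu> Q \<ge> 1 / 2 ^ (k * CARD('n))"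
    using ex_dyadic_cube_measure_ge by blast
  have "2 powr (- (CARD('n) * q) * k) = (1 / 2 ^ (k * CARD('n))) powr q"
    by (simp add: powr_realpow[symmetric] powr_divide powr_powr powr_minus_divide algebra_simps)
  also have "\<dots> \<le> measure \<nu> Q powr q"
    using Q assms by (intro powr_mono2) auto
  also have "\<dots> \<le> power_sum k q"
    unfolding power_sum_def using Q by (intro member_le_sum) (auto simp: finite_dyadic_cubes)
  finally show ?thesis .
qed

lemma power_sum_pos: "q > 0 \<Longrightarrow> power_sum k q > 0"
  using power_sum_ge[of q k] by (smt (verit) powr_gt_zero)

lemma power_sum_le:
  assumes "q > 0" shows "power_sum k q \<le> 2 powr (CARD('n) * k)"
proof -
  have "power_sum k q \<le> of_nat (card (dyadic_cubes k :: (real^'n) set set)) * 1"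
    unfolding power_sum_def using assms
    by (intro sum_bounded_above powr_le1) auto
  also have "\<dots> \<le> 2 powr (CARD('n) * k)"
    using of_nat_mono[OF card_dyadic_cubes_le[where 'n='n, of k], where 'a=real]
    by (simp add: powr_realpow[symmetric] mult.commute)
  finally show ?thesis .
qed

lemma beta_le_iff:
  assumes "q > 0" "k > 0"
  shows "beta \<nu> k q \<le> y \<longleftrightarrow> power_sum k q \<le> 2 powr (y * real k)"
  using log_2_rate_le_iff[OF assms(2) power_sum_pos[OF assms(1)]] by (simp add: beta_eq)

lemma beta_ge:
  fixes q :: real
  assumes "q > 0" "k > 0"
  shows "- (CARD('n) * q) \<le> beta \<nu> k q"
proof -
  have "log 2 (2 powr (- (CARD('n) * q) * k)) \<le> log 2 (power_sum k q)"
    using power_sum_ge[OF assms(1)] power_sum_pos[OF assms(1)] by (subst log_le_cancel_iff) auto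
  then show ?thesis
    using assms(2) by (simp add: beta_eq le_divide_eq)
qed

text \<open>For \<open>k > 0\<close> the exponent \<open>beta \<nu> k q\<close> lies between
  \<open>- (CARD('n) * q)\<close> and \<open>CARD('n)\<close>, so its limit superior is
  finite.\<close>

lemma beta_upper_eq:
  assumes "q > 0" shows "beta_upper \<nu> q = ereal (real_beta q)"
proof -
  have "\<forall>\<^sub>F k in sequentially. ereal (beta \<nu> k q) \<le> ereal (CARD('n))"
    using eventually_gt_at_top[of "0::nat"]
    by eventually_elim (use assms power_sum_le in \<open>simp add: beta_le_iff\<close>)
  then have "beta_upper \<nu> q \<le> ereal (CARD('n))"
    unfolding beta_upper_def by (rule Limsup_bounded)
  moreover have "\<forall>\<^sub>F k in sequentially. ereal (- (CARD('n) * q)) \<le> ereal (beta \<nu> k q)"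
    using eventually_gt_at_top[of "0::nat"]
    by eventually_elim (use assms beta_ge in simp)
  then have "ereal (- (CARD('n) * q)) \<le> beta_upper \<nu> q"
    unfolding beta_upper_def
    by (intro order_trans[OF Liminf_bounded Liminf_le_Limsup]) auto
  ultimately show ?thesis
    unfolding real_beta_def by (cases "beta_upper \<nu> q") auto
qed

lemma real_beta_less_iff:
  "q > 0 \<Longrightarrow> real_beta q < x \<longleftrightarrow> (\<exists>y<x. \<forall>\<^sub>F k in sequentially. beta \<nu> k q \<le> y)"
  using limsup_ereal_less_iff[of "\<lambda>k. beta \<nu> k q" x] beta_upper_eq[of q]
  by (simp add: beta_upper_def)

lemma real_beta_lessD:
  "q > 0 \<Longrightarrow> real_beta q < x \<Longrightarrow> \<forall>\<^sub>F k in sequentially. beta \<nu> k q \<le> x"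
  unfolding real_beta_less_iff by (auto elim: eventually_mono)

lemma real_beta_leI:
  assumes "q > 0" "\<forall>\<^sub>F k in sequentially. beta \<nu> k q \<le> x"
  shows "real_beta q \<le> x"
proof (rule field_le_epsilon)
  fix e :: real assume "e > 0"
  then have "real_beta q < x + e"
    using assms by (subst real_beta_less_iff) (auto intro!: exI[of _ x])
  then show "real_beta q \<le> x + e" by simp
qed

lemma real_beta_one: "real_beta 1 = 0"
  by (simp add: real_beta_def beta_upper_def beta_eq power_sum_def sum_measure_dyadic_cubes Limsup_const)

lemma convex_on_B: "convex_on {0<..} real_beta"
proof (rule convex_onI)
  fix t p q :: real
  assume t: "0 < t" "t < 1" and "p \<in> {0<..}" "q \<in> {0<..}"
  then have pq: "p > 0" "q > 0" by auto
  then have m: "(1 - t) * p + t * q > 0" using t by (simp add: add_pos_pos)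
  \<comment> \<open>Generation exponents may exceed their limit superior, hence the slack
    \<open>e\<close>. The weights sum to 1, so slack \<open>e\<close> at both \<open>p\<close> and
    \<open>q\<close> gives slack exactly \<open>e\<close> at the mixture.\<close>
  have "real_beta ((1 - t) * p + t * q) \<le> ((1 - t) * real_beta p + t * real_beta q) + e" if "e > 0" for e
  proof (rule real_beta_leI[OF m])
    have "\<forall>\<^sub>F k in sequentially. beta \<nu> k p \<le> real_beta p + e" "\<forall>\<^sub>F k in sequentially. beta \<nu> k q \<le> real_beta q + e"
      using pq \<open>e > 0\<close> by (auto intro: real_beta_lessD)
    with eventually_gt_at_top[of "0::nat"]
    show "\<forall>\<^sub>F k in sequentially. beta \<nu> k ((1 - t) * p + t * q) \<le> (1 - t) * real_beta p + t * real_beta q + e"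
    proof eventually_elim
      case (elim k)
      have "power_sum k ((1 - t) * p + t * q) \<le> power_sum k p powr (1 - t) * power_sum k q powr t"
        using sum_powr_log_convex[OF finite_dyadic_cubes _ t, where f = "measure \<nu>"] power_sum_pos[of _ k] pq
        by (simp add: power_sum_def)
      also have "\<dots> \<le> (2 powr ((real_beta p + e) * k)) powr (1 - t) * (2 powr ((real_beta q + e) * k)) powr t"
        using elim t pq power_sum_pos[of _ k]
        by (intro mult_mono powr_mono2) (auto simp: beta_le_iff less_imp_le)
      also have "\<dots> = 2 powr (((1 - t) * real_beta p + t * real_beta q + e) * k)"
        by (simp add: powr_powr powr_add[symmetric] algebra_simps)
      finally show ?case using m elim by (simp add: beta_le_iff)
    qed
  qed
  then show "real_beta ((1 - t) *\<^sub>R p + t *\<^sub>R q) \<le> (1 - t) * real_beta p + t * real_beta q"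
    by (simp add: field_le_epsilon)
qed simp

lemma continuous_on_B: "continuous_on {0<..} real_beta"
  by (intro convex_on_continuous convex_on_B) simp

text \<open>Split \<open>measure \<nu> Q powr q\<close> into the powers \<open>q - p\<close> and
  \<open>p\<close>. The decay rate bounds the first factor uniformly in \<open>Q\<close>, and the
  second one sums to \<open>power_sum k p\<close>.\<close>

lemma real_beta_slope:
  assumes "decay_rate D" "0 < p" "p \<le> q"
  shows "real_beta q \<le> real_beta p - D * (q - p)"
proof (rule field_le_epsilon)
  fix e :: real assume "e > 0"
  have q: "q > 0" using assms by simp
  have "\<forall>\<^sub>F k in sequentially. beta \<nu> k p \<le> real_beta p + e"
    using assms \<open>e > 0\<close> by (auto intro: real_beta_lessD)
  with eventually_gt_at_top[of "0::nat"] assms(1)[unfolded decay_rate_def]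
  have "\<forall>\<^sub>F k in sequentially. beta \<nu> k q \<le> real_beta p - D * (q - p) + e"
  proof eventually_elim
    case (elim k)
    have "power_sum k q = (\<Sum>Q\<in>dyadic_cubes k. measure \<nu> Q powr (q - p) * measure \<nu> Q powr p)"
      by (simp add: power_sum_def powr_add[symmetric])
    also have "\<dots> \<le> (\<Sum>Q\<in>dyadic_cubes k. (2 powr (- D * real k)) powr (q - p) * measure \<nu> Q powr p)"
      using elim(2) assms by (intro sum_mono mult_right_mono powr_mono2) auto
    also have "\<dots> = 2 powr (- D * k * (q - p)) * power_sum k p"
      by (simp add: power_sum_def sum_distrib_left powr_powr)
    also have "\<dots> \<le> 2 powr (- D * k * (q - p)) * 2 powr ((real_beta p + e) * k)"
      using elim assms by (intro mult_left_mono) (auto simp: beta_le_iff)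
    also have "\<dots> = 2 powr ((real_beta p - D * (q - p) + e) * k)"
      by (simp add: powr_add[symmetric] algebra_simps)
    finally show ?case using q elim by (simp add: beta_le_iff)
  qed
  then show "real_beta q \<le> real_beta p - D * (q - p) + e" by (rule real_beta_leI[OF q])
qed

section \<open>The sums of suprema over subcubes\<close>

lemma side_length_powr:
  assumes "Q \<in> dyadic_cubes j" shows "side_length Q powr r = 2 powr (- r * j)"
proof -
  have "side_length Q = 2 powr (- real j)"
    by (simp add: side_length_dyadic_cubes[OF assms] powr_minus powr_realpow power_one_over inverse_eq_divide)
  then show ?thesis by (simp add: powr_powr mult.commute)
qed

text \<open>From generation \<open>K\<close> on, the decay of the mass beats the weight because
  \<open>D + r > 0\<close>. In earlier generations the mass is at most 1 and the weight at most
  \<open>2 powr (\<bar>r\<bar> * K)\<close>.\<close>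

lemma bdd_above_weighted_measure:
  assumes "decay_rate D" "D + r > 0"
  shows "bdd_above ((\<lambda>Q'. measure \<nu> Q' * side_length Q' powr r) ` {Q' \<in> all_dyadic_cubes. Q' \<subseteq> Q})"
proof -
  obtain K where K: "\<And>j Q. j \<ge> K \<Longrightarrow> Q \<in> dyadic_cubes j \<Longrightarrow> measure \<nu> Q \<le> 2 powr (- D * real j)"
    using assms(1) unfolding decay_rate_def eventually_sequentially by blast
  have "measure \<nu> Q * side_length Q powr r \<le> 2 powr (\<bar>r\<bar> * K)" if Q: "Q \<in> dyadic_cubes j" for Q j
  proof (cases "j \<ge> K")
    case True
    have "measure \<nu> Q * side_length Q powr r \<le> 2 powr (- D * real j) * 2 powr (- r * j)"
      unfolding side_length_powr[OF Q] using K[OF True Q] by (intro mult_right_mono) auto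
    also have "\<dots> = 2 powr (- ((D + r) * j))" by (simp add: powr_add[symmetric] algebra_simps)
    also have "\<dots> \<le> 2 powr (\<bar>r\<bar> * K)"
    proof (rule powr_mono)
      have "0 \<le> (D + r) * j" "0 \<le> \<bar>r\<bar> * K" using assms(2) by auto
      then show "- ((D + r) * j) \<le> \<bar>r\<bar> * K" by linarith
    qed simp
    finally show ?thesis .
  next
    case False
    have "measure \<nu> Q * side_length Q powr r \<le> 1 * 2 powr (- r * j)"
      unfolding side_length_powr[OF Q] by (intro mult_right_mono) auto
    also have "\<dots> \<le> 2 powr (\<bar>r\<bar> * K)"
    proof -
      have "- r * j \<le> \<bar>r\<bar> * j" by (intro mult_right_mono) auto
      also have "\<dots> \<le> \<bar>r\<bar> * K" using False by (intro mult_left_mono) auto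
      finally show ?thesis by (simp add: powr_mono)
    qed
    finally show ?thesis .
  qed
  then show ?thesis by (intro bdd_aboveI2) (auto simp: all_dyadic_cubes_def)
qed

text \<open>The cube \<open>Q\<close> competes in its own supremum. As \<open>J\<close> is a real
  supremum, boundedness above is what turns this into a lower bound.\<close>

lemma J_ge:
  assumes "decay_rate D" "D + r > 0" "Q \<in> dyadic_cubes k"
  shows "measure \<nu> Q * 2 powr (- r * k) \<le> J \<nu> r Q"
  unfolding J_def side_length_powr[OF assms(3), symmetric]
  using assms(3) by (intro cSUP_upper bdd_above_weighted_measure[OF assms(1,2)])
    (auto simp: all_dyadic_cubes_def)

lemma J_nonneg:
  assumes "decay_rate D" "D + r > 0" "Q \<in> dyadic_cubes k"
  shows "0 \<le> J \<nu> r Q"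
  by (rule order_trans[OF _ J_ge[OF assms]]) simp

lemma sum_J_ge:
  assumes "decay_rate D" "D + r > 0" "q > 0"
  shows "power_sum k q * 2 powr (- r * q * k) \<le> (\<Sum>Q\<in>dyadic_cubes k. J \<nu> r Q powr q)"
proof -
  have "power_sum k q * 2 powr (- r * q * k)
      = (\<Sum>Q\<in>dyadic_cubes k. (measure \<nu> Q * 2 powr (- r * k)) powr q)"
    by (simp add: power_sum_def sum_distrib_right powr_mult powr_powr mult_ac)
  also have "\<dots> \<le> (\<Sum>Q\<in>dyadic_cubes k. J \<nu> r Q powr q)"
    using assms J_ge[OF assms(1,2)] by (intro sum_mono powr_mono2) auto
  finally show ?thesis .
qed

lemma sum_J_pos:
  assumes "decay_rate D" "D + r > 0" "q > 0"
  shows "(\<Sum>Q\<in>dyadic_cubes k. J \<nu> r Q powr q) > 0"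
  by (rule less_le_trans[OF _ sum_J_ge[OF assms]]) (simp add: power_sum_pos assms)

text \<open>A strictly negative exponent amounts to exponential decay of the sums. Their positivity,
  from \<open>sum_J_pos\<close>, allows the logarithm to be removed.\<close>

lemma Theta_neg_iff:
  assumes "decay_rate D" "D + r > 0" "q > 0"
  shows "Theta \<nu> r q < 0 \<longleftrightarrow> (\<exists>c>0. \<forall>\<^sub>F k in sequentially.
    (\<Sum>Q\<in>dyadic_cubes k. J \<nu> r Q powr q) \<le> 2 powr (- c * real k))" (is "_ \<longleftrightarrow> ?R")
proof -
  have "Theta \<nu> r q < 0 \<longleftrightarrow> (\<exists>y<0. \<forall>\<^sub>F k in sequentially.
      1 / real k * log 2 (\<Sum>Q\<in>dyadic_cubes k. J \<nu> r Q powr q) \<le> y)"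
    unfolding Theta_def zero_ereal_def by (rule limsup_ereal_less_iff)
  also have "\<dots> \<longleftrightarrow> (\<exists>y<0. \<forall>\<^sub>F k in sequentially.
      (\<Sum>Q\<in>dyadic_cubes k. J \<nu> r Q powr q) \<le> 2 powr (y * real k))"
  proof (intro ex_cong conj_cong refl eventually_subst)
    fix y
    show "\<forall>\<^sub>F k in sequentially. (1 / real k * log 2 (\<Sum>Q\<in>dyadic_cubes k. J \<nu> r Q powr q) \<le> y) =
      ((\<Sum>Q\<in>dyadic_cubes k. J \<nu> r Q powr q) \<le> 2 powr (y * real k))"
      using eventually_gt_at_top[of "0::nat"]
      by eventually_elim (rule log_2_rate_le_iff[OF _ sum_J_pos[OF assms]])
  qed
  also have "\<dots> \<longleftrightarrow> ?R"
  proof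
    assume "\<exists>y<0. \<forall>\<^sub>F k in sequentially.
      (\<Sum>Q\<in>dyadic_cubes k. J \<nu> r Q powr q) \<le> 2 powr (y * real k)"
    then obtain y where "y < 0" "\<forall>\<^sub>F k in sequentially.
      (\<Sum>Q\<in>dyadic_cubes k. J \<nu> r Q powr q) \<le> 2 powr (y * real k)" by blast
    then show ?R by (intro exI[of _ "- y"]) simp
  next
    assume ?R
    then obtain c where "c > 0" "\<forall>\<^sub>F k in sequentially.
      (\<Sum>Q\<in>dyadic_cubes k. J \<nu> r Q powr q) \<le> 2 powr (- c * real k)" by blast
    then show "\<exists>y<0. \<forall>\<^sub>F k in sequentially.
      (\<Sum>Q\<in>dyadic_cubes k. J \<nu> r Q powr q) \<le> 2 powr (y * real k)"
      by (intro exI[of _ "- c"]) simp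
  qed
  finally show ?thesis .
qed

lemma real_beta_less_if_Theta_neg:
  assumes "decay_rate D" "D + r > 0" "q > 0" "Theta \<nu> r q < 0"
  shows "real_beta q < r * q"
proof -
  obtain c where c: "c > 0" "\<forall>\<^sub>F k in sequentially.
    (\<Sum>Q\<in>dyadic_cubes k. J \<nu> r Q powr q) \<le> 2 powr (- c * real k)"
    using assms Theta_neg_iff by blast
  have "\<forall>\<^sub>F k in sequentially. beta \<nu> k q \<le> r * q - c"
    using c(2) eventually_gt_at_top[of "0::nat"]
  proof eventually_elim
    case (elim k)
    have "power_sum k q * 2 powr (- r * q * k) * 2 powr (r * q * k)
        \<le> 2 powr (- c * real k) * 2 powr (r * q * k)"
      by (intro mult_right_mono order_trans[OF sum_J_ge[OF assms(1-3)] elim(1)]) simp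
    then have "power_sum k q \<le> 2 powr ((r * q - c) * real k)"
      by (simp add: mult.assoc powr_add[symmetric] algebra_simps)
    then show ?case using elim assms by (simp add: beta_le_iff)
  qed
  then have "real_beta q \<le> r * q - c" by (rule real_beta_leI[OF assms(3)])
  then show ?thesis using c by simp
qed

text \<open>Cubes of generation \<open>k\<close> are disjoint and each \<open>Q'\<close> is
  nonempty, so every \<open>Q'\<close> is counted at most once.\<close>

lemma sum_subcubes_le:
  assumes "\<And>Q'. Q' \<in> dyadic_cubes j \<Longrightarrow> f Q' \<ge> (0::real)"
  shows "(\<Sum>Q\<in>dyadic_cubes k. \<Sum>Q'\<in>{Q'\<in>dyadic_cubes j. Q' \<subseteq> Q}. f Q') \<le> sum f (dyadic_cubes j)"
proof -
  have "(\<Sum>Q\<in>dyadic_cubes k. \<Sum>Q'\<in>{Q'\<in>dyadic_cubes j. Q' \<subseteq> Q}. f Q') =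
      sum f (\<Union>Q\<in>dyadic_cubes k. {Q'\<in>dyadic_cubes j. Q' \<subseteq> Q})"
  proof (intro sum.UNION_disjoint[symmetric] ballI impI)
    fix Q1 Q2 assume *: "Q1 \<in> dyadic_cubes k" "Q2 \<in> dyadic_cubes k" "Q1 \<noteq> Q2"
    show "{Q' \<in> dyadic_cubes j. Q' \<subseteq> Q1} \<inter> {Q' \<in> dyadic_cubes j. Q' \<subseteq> Q2} = {}"
    proof (rule equals0I)
      fix Q' assume "Q' \<in> {Q' \<in> dyadic_cubes j. Q' \<subseteq> Q1} \<inter> {Q' \<in> dyadic_cubes j. Q' \<subseteq> Q2}"
      then have Q': "Q' \<in> dyadic_cubes j" "Q' \<subseteq> Q1" "Q' \<subseteq> Q2" by auto
      from Q'(1) obtain x where "x \<in> Q'" using dyadic_cubes_member_nonempty by blast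
      then show False using dyadic_cubes_disjoint[OF *(1,2), of x] Q' *(3) by blast
    qed
  qed (auto simp: finite_dyadic_cubes)
  also have "\<dots> \<le> sum f (dyadic_cubes j)"
    using assms by (intro sum_mono2) (auto simp: finite_dyadic_cubes)
  finally show ?thesis .
qed

text \<open>A supremum of \<open>q\<close>-th powers is at most their sum. Grouped by generation and
  summed over \<open>Q\<close>, the subcubes contribute at most \<open>2 powr (- c * j)\<close> in
  generation \<open>j\<close>, and the geometric tail from \<open>k\<close> on gives the
  bound.\<close>

lemma sum_J_le:
  assumes D: "decay_rate D" "D + r > 0" and q: "q > 0" and c: "c > 0"
    and S: "\<And>j. j \<ge> k \<Longrightarrow> power_sum j q \<le> 2 powr ((r * q - c) * j)"
  shows "(\<Sum>Q\<in>dyadic_cubes k. J \<nu> r Q powr q) \<le> 2 powr (- c * k) / (1 - 2 powr (- c))"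
proof -
  \<comment> \<open>The contribution of the subcubes lying \<open>i\<close> generations below
    \<open>Q\<close>.\<close>
  define W where "W Q i = (\<Sum>Q'\<in>{Q'\<in>dyadic_cubes (k + i). Q' \<subseteq> Q}.
      (measure \<nu> Q' * side_length Q' powr r) powr q)" for Q i
  have W0: "W Q i \<ge> 0" for Q i by (simp add: W_def sum_nonneg)
  have sumW: "(\<Sum>Q\<in>dyadic_cubes k. W Q i) \<le> 2 powr (- c * k) * (2 powr (- c)) ^ i" for i
  proof -
    have "(\<Sum>Q\<in>dyadic_cubes k. W Q i)
        \<le> (\<Sum>Q'\<in>dyadic_cubes (k + i). (measure \<nu> Q' * side_length Q' powr r) powr q)"
      unfolding W_def by (rule sum_subcubes_le) simp
    also have "\<dots> = power_sum (k + i) q * 2 powr (- r * q * (k + i))"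
      by (simp add: power_sum_def sum_distrib_right powr_mult powr_powr side_length_powr mult_ac
          cong: sum.cong)
    also have "\<dots> \<le> 2 powr ((r * q - c) * (k + i)) * 2 powr (- r * q * (k + i))"
      using S[of "k + i"] by (intro mult_right_mono) auto
    also have "\<dots> = 2 powr (- c * k) * (2 powr (- c)) ^ i"
      by (simp add: powr_realpow[symmetric] powr_powr powr_add[symmetric] algebra_simps)
    finally show ?thesis .
  qed
  have x: "2 powr (- c) < 1" using c by (simp add: powr_less_one)
  have geom: "summable (\<lambda>i. 2 powr (- c * k) * (2 powr (- c)) ^ i)"
    using x by (intro summable_mult summable_geometric) simp
  have summ: "summable (W Q)" if "Q \<in> dyadic_cubes k" for Q
  proof (rule summable_comparison_test[OF _ geom], intro exI allI impI)
    fix i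
    have "W Q i \<le> (\<Sum>Q\<in>dyadic_cubes k. W Q i)"
      using that W0 by (intro member_le_sum) (auto simp: finite_dyadic_cubes)
    then show "norm (W Q i) \<le> 2 powr (- c * k) * (2 powr (- c)) ^ i"
      using sumW[of i] W0[of Q i] by simp
  qed
  have J_le: "J \<nu> r Q powr q \<le> suminf (W Q)" if Q: "Q \<in> dyadic_cubes k" for Q
  proof -
    \<comment> \<open>The supremum in \<open>J\<close> is taken before the power \<open>q\<close>,
      so each competitor is bounded by a \<open>q\<close>-th root.\<close>
    have "measure \<nu> Q' * side_length Q' powr r \<le> suminf (W Q) powr (1 / q)"
      if Q': "Q' \<in> all_dyadic_cubes" "Q' \<subseteq> Q" for Q'
    proof -
      obtain j where j: "Q' \<in> dyadic_cubes j" using Q' by (auto simp: all_dyadic_cubes_def)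
      then have "k \<le> j" using dyadic_cubes_subset_level[OF _ Q Q'(2)] by simp
      then obtain i where i: "j = k + i" using le_Suc_ex by blast
      have "(measure \<nu> Q' * side_length Q' powr r) powr q \<le> W Q i"
        unfolding W_def using j i Q'
        by (intro member_le_sum[of Q' _ "\<lambda>Q'. (measure \<nu> Q' * side_length Q' powr r) powr q"])
           (auto simp: finite_dyadic_cubes)
      also have "\<dots> \<le> suminf (W Q)"
        using sum_le_suminf[OF summ[OF Q], of "{i}"] W0 by simp
      finally have "((measure \<nu> Q' * side_length Q' powr r) powr q) powr (1 / q)
          \<le> suminf (W Q) powr (1 / q)"
        using q by (intro powr_mono2) auto
      then show ?thesis using q by (simp add: powr_powr)
    qed
    then have "J \<nu> r Q \<le> suminf (W Q) powr (1 / q)"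
      unfolding J_def using Q by (intro cSUP_least) (auto simp: all_dyadic_cubes_def)
    then have "J \<nu> r Q powr q \<le> (suminf (W Q) powr (1 / q)) powr q"
      using q J_nonneg[OF D Q] by (intro powr_mono2) auto
    then show ?thesis
      using q suminf_nonneg[OF summ[OF Q] W0] by (simp add: powr_powr)
  qed
  have "(\<Sum>Q\<in>dyadic_cubes k. J \<nu> r Q powr q) \<le> (\<Sum>Q\<in>dyadic_cubes k. suminf (W Q))"
    by (intro sum_mono J_le)
  also have "\<dots> = (\<Sum>i. \<Sum>Q\<in>dyadic_cubes k. W Q i)"
    by (rule suminf_sum[symmetric]) (rule summ)
  also have "\<dots> \<le> (\<Sum>i. 2 powr (- c * k) * (2 powr (- c)) ^ i)"
    by (intro suminf_le sumW summable_sum summ geom)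
  also have "\<dots> = 2 powr (- c * k) / (1 - 2 powr (- c))"
    using x by (simp add: suminf_mult suminf_geometric summable_geometric)
  finally show ?thesis .
qed

lemma Theta_neg_if_B_less:
  assumes D: "decay_rate D" "D + r > 0" and q: "q > 0" and "real_beta q < r * q"
  shows "Theta \<nu> r q < 0"
proof -
  obtain y where y: "y < r * q" "\<forall>\<^sub>F k in sequentially. beta \<nu> k q \<le> y"
    using assms(4) real_beta_less_iff[OF q] by blast
  define c where "c = r * q - y"
  have c: "c > 0" using y by (simp add: c_def)
  have "\<forall>\<^sub>F k in sequentially. power_sum k q \<le> 2 powr ((r * q - c) * k)"
    using y(2) eventually_gt_at_top[of "0::nat"]
    by eventually_elim (use q in \<open>simp add: beta_le_iff c_def\<close>)
  then obtain K where K: "\<And>k. k \<ge> K \<Longrightarrow> power_sum k q \<le> 2 powr ((r * q - c) * k)"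
    unfolding eventually_sequentially by blast
  define A where "A = 1 - 2 powr (- c)"
  have A: "A > 0" using c by (simp add: A_def powr_less_one)
  \<comment> \<open>Half of the rate \<open>c\<close> is spent on absorbing the constant
    \<open>1 / A\<close>; the other half remains as decay.\<close>
  have "(\<lambda>k. 2 powr (- (c / 2) * real k)) \<longlonglongrightarrow> 0"
    using c by real_asymp
  then have "\<forall>\<^sub>F k in sequentially. 2 powr (- (c / 2) * real k) < A"
    using A by (rule order_tendstoD)
  then have "\<forall>\<^sub>F k in sequentially.
      (\<Sum>Q\<in>dyadic_cubes k. J \<nu> r Q powr q) \<le> 2 powr (- (c / 2) * real k)"
    using eventually_ge_at_top[of K]
  proof eventually_elim
    case (elim k)
    have "(\<Sum>Q\<in>dyadic_cubes k. J \<nu> r Q powr q) \<le> 2 powr (- c * k) / A"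
      unfolding A_def using elim K by (intro sum_J_le[OF D q c]) auto
    also have "2 powr (- c * k) = 2 powr (- (c / 2) * real k) * 2 powr (- (c / 2) * real k)"
      by (simp add: powr_add[symmetric])
    also have "\<dots> \<le> A * 2 powr (- (c / 2) * real k)"
      using elim by (intro mult_right_mono) auto
    finally show ?case using A by (simp add: divide_right_mono)
  qed
  then show ?thesis
    unfolding Theta_neg_iff[OF D q] using c half_gt_zero by blast
qed

section \<open>The critical exponent\<close>

text \<open>The intermediate value theorem applied to \<open>real_beta q - r * q\<close>, which is
  continuous on positive \<open>q\<close> and changes sign between \<open>p\<close> and
  \<open>s\<close>.\<close>

lemma ex_root:
  assumes D: "decay_rate D" "D > 0" "D + r > 0"
  shows "\<exists>q>0. real_beta q = r * q"
proof -
  \<comment> \<open>With \<open>real_beta 1 = 0\<close>, the slope bound gives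
    \<open>real_beta p - r * p \<ge> D - p * (D + r)\<close> for \<open>p \<le> 1\<close> and
    \<open>real_beta s - r * s \<le> D - s * (D + r)\<close> for \<open>s \<ge> 1\<close>. The
    choices make the first right side nonnegative and the second nonpositive.\<close>
  define p where "p = D / (2 * (D + \<bar>r\<bar>))"
  define s where "s = 1 + \<bar>r\<bar> / (D + r)"
  have p: "0 < p" "p \<le> 1" "p * (D + \<bar>r\<bar>) = D / 2"
    using D by (auto simp: p_def field_simps)
  have "s * (D + r) = D + r + \<bar>r\<bar>" "1 \<le> s"
    using D by (auto simp: s_def field_simps)
  then have s: "1 \<le> s" "s * (D + r) \<ge> D" by linarith+
  have "D * (1 - p) \<le> real_beta p"
    using real_beta_slope[OF D(1) p(1,2)] by (simp add: real_beta_one)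
  moreover have "p * (D + r) \<le> D / 2"
    unfolding p(3)[symmetric] using p by (intro mult_left_mono) auto
  then have "D * p + r * p \<le> D / 2" by (simp add: algebra_simps)
  ultimately have lo: "real_beta p - r * p \<ge> 0"
    using D(2) unfolding right_diff_distrib by linarith
  have "real_beta s \<le> - D * (s - 1)"
    using real_beta_slope[OF D(1) _ s(1)] by (simp add: real_beta_one)
  then have hi: "real_beta s - r * s \<le> 0" using s by (simp add: algebra_simps)
  have "continuous_on {p..s} (\<lambda>q. real_beta q - r * q)"
    using p by (intro continuous_intros continuous_on_subset[OF continuous_on_B]) auto
  then obtain q where "q \<ge> p" "real_beta q - r * q = 0"
    using IVT2'[of "\<lambda>q. real_beta q - r * q" s 0 p] lo hi p s by auto
  then show ?thesis using p by (intro exI[of _ q]) auto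
qed

text \<open>The slopes of \<open>real_beta\<close> are at most \<open>- D\<close>, so those of the
  difference are at most \<open>- (D + r) < 0\<close>.\<close>

lemma real_beta_diff_strict_antimono:
  assumes "decay_rate D" "D + r > 0" "0 < p" "p < q"
  shows "real_beta q - r * q < real_beta p - r * p"
proof -
  have "0 < (D + r) * (q - p)" using assms by simp
  with real_beta_slope[of D p q] assms show ?thesis by (simp add: algebra_simps)
qed

text \<open>By strict monotonicity the set defining the critical exponent is the open ray above the
  root \<open>c\<close>, whose infimum is \<open>c\<close>. Uniqueness of the root comes with
  it.\<close>

lemma crit_exponent_eqI:
  assumes D: "decay_rate D" "D + r > 0" and c: "c > 0" "real_beta c = r * c"
  shows "crit_exponent \<nu> r = c"
proof -
  have "q > 0 \<and> Theta \<nu> r q < 0 \<longleftrightarrow> c < q" for q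
  proof (cases "q > 0")
    case True
    then have "Theta \<nu> r q < 0 \<longleftrightarrow> real_beta q < r * q"
      using D real_beta_less_if_Theta_neg Theta_neg_if_B_less by blast
    also have "\<dots> \<longleftrightarrow> c < q"
      using real_beta_diff_strict_antimono[OF D c(1), of q] real_beta_diff_strict_antimono[OF D True, of c] c(2)
      by (cases q c rule: linorder_cases) auto
    finally show ?thesis using True by simp
  qed (use c in auto)
  then have "{q. q > 0 \<and> Theta \<nu> r q < 0} = {c<..}" by auto
  then show ?thesis by (simp add: crit_exponent_def)
qed

lemma crit_exponent_root:
  assumes "decay_rate D" "D > 0" "D + r > 0"
  shows "crit_exponent \<nu> r > 0" "real_beta (crit_exponent \<nu> r) = r * crit_exponent \<nu> r"
  using ex_root[OF assms] crit_exponent_eqI[OF assms(1,3)] by auto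

section \<open>Position relative to 1 and the limit at 0\<close>

lemma crit_exponent_gt_1:
  assumes "decay_rate D" "D > 0" "D + r > 0" "r < 0"
  shows "crit_exponent \<nu> r > 1"
proof (rule ccontr)
  let ?c = "crit_exponent \<nu> r"
  assume c: "\<not> 1 < ?c"
  \<comment> \<open>The slope bound from \<open>?c\<close> to 1 forces
    \<open>real_beta ?c \<ge> 0\<close>, whereas the root equation makes it negative.\<close>
  have "0 \<le> r * ?c - D * (1 - ?c)"
    using real_beta_slope[OF assms(1), of ?c 1] crit_exponent_root[OF assms(1-3)] c by (simp add: real_beta_one)
  moreover have "r * ?c < 0" "D * (1 - ?c) \<ge> 0"
    using assms c crit_exponent_root[OF assms(1-3)] by (auto simp: mult_neg_pos)
  ultimately show False by simp
qed

lemma crit_exponent_less_1: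
  assumes "decay_rate D" "D > 0" "r > 0"
  shows "crit_exponent \<nu> r < 1"
proof (rule ccontr)
  let ?c = "crit_exponent \<nu> r"
  assume c: "\<not> ?c < 1"
  have "D + r > 0" using assms by simp
  then have "r * ?c \<le> - D * (?c - 1)"
    using real_beta_slope[OF assms(1), of 1 ?c] crit_exponent_root[OF assms(1,2)] c by (simp add: real_beta_one)
  moreover have "r * ?c > 0" "D * (?c - 1) \<ge> 0"
    using assms c by auto
  ultimately show False by simp
qed

text \<open>Since \<open>real_beta 1 = 0\<close>, the slope bound makes
  \<open>D * \<bar>c - 1\<bar>\<close> at most
  \<open>\<bar>real_beta c\<bar> = \<bar>r\<bar> * c\<close> at the root \<open>c\<close>. Writing
  \<open>c \<le> \<bar>c - 1\<bar> + 1\<close>, the assumption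
  \<open>\<bar>r\<bar> \<le> D / 2\<close> lets half of the left side absorb the term with
  \<open>\<bar>c - 1\<bar>\<close>.\<close>

lemma crit_exponent_dist_1_le:
  assumes D: "decay_rate D" "D > 0" and r: "\<bar>r\<bar> \<le> D / 2"
  shows "\<bar>crit_exponent \<nu> r - 1\<bar> \<le> \<bar>r\<bar> * (2 / D)"
proof -
  define c where "c = crit_exponent \<nu> r"
  have Dr: "D + r > 0" using assms by auto
  have c: "c > 0" "real_beta c = r * c"
    using crit_exponent_root[OF D Dr] by (auto simp: c_def)
  have "D * \<bar>c - 1\<bar> \<le> \<bar>r * c\<bar>"
  proof (cases "c \<ge> 1")
    case True
    then show ?thesis using real_beta_slope[OF D(1), of 1 c] c by (simp add: real_beta_one)
  next
    case False
    then show ?thesis using real_beta_slope[OF D(1), of c 1] c by (simp add: real_beta_one)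
  qed
  also have "\<dots> = \<bar>r\<bar> * c" using c by (simp add: abs_mult)
  also have "\<dots> \<le> \<bar>r\<bar> * (\<bar>c - 1\<bar> + 1)" by (intro mult_left_mono) auto
  also have "\<dots> \<le> D / 2 * \<bar>c - 1\<bar> + \<bar>r\<bar>"
    using mult_right_mono[OF r, of "\<bar>c - 1\<bar>"] by (simp add: distrib_left)
  finally have "D * \<bar>c - 1\<bar> \<le> 2 * \<bar>r\<bar>" by simp
  then show ?thesis using D by (simp add: c_def le_divide_eq mult.commute)
qed

lemma crit_exponent_tendsto_1:
  assumes "decay_rate D" "D > 0"
  shows "(crit_exponent \<nu> \<longlongrightarrow> 1) (at 0)"
proof -
  have "\<forall>\<^sub>F r in at 0. \<bar>r\<bar> < D / 2"
    using assms by (intro order_tendstoD[OF tendsto_rabs_zero[OF tendsto_ident_at]]) simp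
  then have "\<forall>\<^sub>F r in at 0. norm (crit_exponent \<nu> r - 1) \<le> \<bar>r\<bar> * (2 / D)"
    by eventually_elim (use crit_exponent_dist_1_le[OF assms] in simp)
  moreover have "((\<lambda>r. \<bar>r\<bar> * (2 / D)) \<longlongrightarrow> 0) (at 0)"
    by (intro tendsto_mult_left_zero tendsto_rabs_zero tendsto_ident_at)
  ultimately have "((\<lambda>r. crit_exponent \<nu> r - 1) \<longlongrightarrow> 0) (at 0)"
    by (rule Lim_null_comparison)
  then show ?thesis by (simp add: LIM_zero_iff)
qed

section \<open>Decay rates from the dimension\<close>

lemma decay_rate_if_less_dim_infty:
  assumes "ereal D < dim_infty \<nu>" shows "decay_rate D"
proof -
  have "\<forall>\<^sub>F k in sequentially. ereal D < ereal (- log 2 (Max (measure \<nu> ` dyadic_cubes k)) / real k)"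
    using less_LiminfD assms unfolding dim_infty_def by blast
  then show ?thesis
    unfolding decay_rate_def using eventually_gt_at_top[of "0::nat"]
  proof eventually_elim
    case (elim k)
    let ?M = "Max (measure \<nu> ` dyadic_cubes k)"
    have le: "measure \<nu> Q \<le> ?M" if "Q \<in> dyadic_cubes k" for Q
      using that by (intro Max_ge) (auto simp: finite_dyadic_cubes)
    obtain Q where "Q \<in> dyadic_cubes k" "measure \<nu> Q \<ge> 1 / 2 ^ (k * CARD('n))"
      using ex_dyadic_cube_measure_ge by blast
    moreover have "(0::real) < 1 / 2 ^ (k * CARD('n))" by simp
    ultimately have "?M > 0" using le by (meson less_le_trans)
    moreover have "log 2 ?M \<le> - D * k"
      using elim by (simp add: field_simps)
    ultimately have "?M \<le> 2 powr (- D * k)" by (simp add: log_le_iff)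
    then show ?case using le by (meson order_trans)
  qed
qed

text \<open>The constant \<open>C\<close> costs only \<open>log 2 C / k\<close>, which is eventually
  below \<open>a / 2\<close>; the remaining \<open>a / 2\<close> bounds the dimension from
  below.\<close>

lemma dim_infty_pos:
  assumes "a > 0" "C \<ge> 1"
    and "\<And>k Q. Q \<in> dyadic_cubes k \<Longrightarrow> measure \<nu> Q \<le> C * 2 powr (- a * real k)"
  shows "dim_infty \<nu> > 0"
proof -
  have "(\<lambda>k. log 2 C / real k) \<longlonglongrightarrow> 0" by real_asymp
  then have "\<forall>\<^sub>F k in sequentially. log 2 C / real k < a / 2"
    using assms(1) by (intro order_tendstoD) auto
  then have "\<forall>\<^sub>F k in sequentially. ereal (a / 2) \<le> ereal (- log 2 (Max (measure \<nu> ` dyadic_cubes k)) / real k)"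
    using eventually_gt_at_top[of "0::nat"]
  proof eventually_elim
    case (elim k)
    let ?M = "Max (measure \<nu> ` dyadic_cubes k)"
    have M: "?M \<in> measure \<nu> ` dyadic_cubes k"
      by (intro Max_in) (auto simp: finite_dyadic_cubes dyadic_cubes_nonempty)
    obtain Q where Q: "Q \<in> dyadic_cubes k" "measure \<nu> Q \<ge> 1 / 2 ^ (k * CARD('n))"
      using ex_dyadic_cube_measure_ge by blast
    then have "measure \<nu> Q \<le> ?M" by (intro Max_ge) (auto simp: finite_dyadic_cubes)
    moreover have "(0::real) < 1 / 2 ^ (k * CARD('n))" by simp
    ultimately have "?M > 0" using Q by linarith
    moreover have "?M \<le> C * 2 powr (- a * k)" using M assms(3) by auto
    ultimately have "log 2 ?M \<le> log 2 (C * 2 powr (- a * k))"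
      using assms(2) by (subst log_le_cancel_iff) auto
    also have "\<dots> = log 2 C - a * k" using assms(2) by (simp add: log_mult)
    finally have "log 2 ?M / k \<le> log 2 C / k - a"
      using elim by (simp add: field_simps)
    then have "a / 2 \<le> - (log 2 ?M / k)" using elim by linarith
    then show ?case by simp
  qed
  then have "ereal (a / 2) \<le> dim_infty \<nu>"
    unfolding dim_infty_def by (rule Liminf_bounded)
  moreover have "0 < ereal (a / 2)" using assms(1) by simp
  ultimately show ?thesis by (rule less_le_trans[rotated])
qed

text \<open>Both \<open>0\<close> and \<open>- r\<close> lie strictly below the dimension, so a real
  \<open>D\<close> fits between their maximum and it.\<close>

lemma ex_decay_rate:
  assumes "dim_infty \<nu> > 0" "- dim_infty \<nu> < ereal r"
  shows "\<exists>D>0. D + r > 0 \<and> decay_rate D"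
proof -
  have "ereal (- r) < dim_infty \<nu>"
    using assms(2) by (cases "dim_infty \<nu>") auto
  then have "ereal (max 0 (- r)) < dim_infty \<nu>"
    using assms(1) by (simp add: max_def zero_ereal_def)
  then obtain D where "ereal (max 0 (- r)) < ereal D" "ereal D < dim_infty \<nu>"
    using ereal_dense2 by blast
  then show ?thesis
    using decay_rate_if_less_dim_infty by (intro exI[of _ D]) auto
qed

end

theorem lemma4p2:
  fixes \<nu> :: "(real ^ 'n::finite) measure" and a C :: real
  assumes "prob_space \<nu>"
    and "sets \<nu> = sets borel"
    and "measure_support \<nu> \<subseteq> interior {x. \<forall>i. 0 \<le> x $ i \<and> x $ i \<le> 1}"
    and "a > 0" and "C \<ge> 1"
    and "\<And>k Q. Q \<in> dyadic_cubes k \<Longrightarrow> measure \<nu> Q \<le> C * 2 powr (- a * real k)"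
  shows "(\<forall>r. - dim_infty \<nu> < ereal r \<longrightarrow>
            crit_exponent \<nu> r > 0 \<and>
            beta_upper \<nu> (crit_exponent \<nu> r) = ereal (r * crit_exponent \<nu> r) \<and>
            (\<forall>q>0. beta_upper \<nu> q = ereal (r * q) \<longrightarrow> q = crit_exponent \<nu> r))
       \<and> crit_exponent \<nu> 0 = 1
       \<and> (\<forall>r. - dim_infty \<nu> < ereal r \<longrightarrow> r < 0 \<longrightarrow> crit_exponent \<nu> r > 1)
       \<and> (\<forall>r. - dim_infty \<nu> < ereal r \<longrightarrow> r > 0 \<longrightarrow> crit_exponent \<nu> r < 1)
       \<and> (crit_exponent \<nu> \<longlongrightarrow> 1) (at 0)"
proof -
  interpret prob_space \<nu> by fact
  have "closed (unit_cube :: (real ^ 'n) set)"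
    by (intro closed_Collect_all closed_Collect_conj closed_Collect_le continuous_intros)
  then have unit_cube: "unit_cube \<in> sets \<nu>" by (simp add: assms(2))
  have "measure_support \<nu> \<subseteq> unit_cube"
    using assms(3) interior_subset by blast
  then have "AE x in \<nu>. x \<in> unit_cube"
    using null_Compl_measure_support[OF assms(2)] by (intro AE_I'[of "- measure_support \<nu>"]) auto
  then have "prob unit_cube = 1" by (rule prob_eq_1[OF unit_cube, THEN iffD2])
  then interpret unit_cube_prob \<nu>
    by unfold_locales (use assms(2) in auto)
  have pos: "dim_infty \<nu> > 0" by (rule dim_infty_pos[OF assms(4-6)])
  have dim0: "- dim_infty \<nu> < ereal 0"
    using pos by (cases "dim_infty \<nu>") auto
  have "crit_exponent \<nu> r > 0 \<and>
      beta_upper \<nu> (crit_exponent \<nu> r) = ereal (r * crit_exponent \<nu> r) \<and>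
      (\<forall>q>0. beta_upper \<nu> q = ereal (r * q) \<longrightarrow> q = crit_exponent \<nu> r) \<and>
      (r < 0 \<longrightarrow> crit_exponent \<nu> r > 1) \<and> (r > 0 \<longrightarrow> crit_exponent \<nu> r < 1)"
    if r: "- dim_infty \<nu> < ereal r" for r
  proof -
    obtain D where D: "decay_rate D" "D > 0" "D + r > 0"
      using ex_decay_rate[OF pos r] by blast
    have "\<forall>q>0. beta_upper \<nu> q = ereal (r * q) \<longrightarrow> q = crit_exponent \<nu> r"
      using crit_exponent_eqI[OF D(1,3)] by (auto simp: beta_upper_eq)
    moreover have "beta_upper \<nu> (crit_exponent \<nu> r) = ereal (r * crit_exponent \<nu> r)"
      using crit_exponent_root[OF D] by (simp add: beta_upper_eq)
    ultimately show ?thesis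
      using crit_exponent_root(1)[OF D] crit_exponent_gt_1[OF D] crit_exponent_less_1[OF D(1,2)]
      by blast
  qed
  \<comment> \<open>One positive rate, fixed independently of \<open>r\<close>, serves the value at
    0 and the limit. It comes from \<open>r = 0\<close>, which is admissible because the dimension
    is positive.\<close>
  moreover obtain D where D: "decay_rate D" "D > 0"
    using ex_decay_rate[OF pos dim0] by blast
  moreover have "crit_exponent \<nu> 0 = 1"
    using D by (intro crit_exponent_eqI) (auto simp: real_beta_one)
  ultimately show ?thesis
    using crit_exponent_tendsto_1[OF D] by blast
qed

end
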